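(* For every positive integer $n$, $$\int_{-1}^{1} \left( \frac{P_{n}(x)-P_{n}(0)}{x} \right)^{2} dx = 2\left[ 1 - \beta(n)^{2} \right],$$ where $P_n$ is the $n$-th Legendre polynomial and $\beta(n)=0$ if $n$ is odd, $\beta(n) = 2^{-n}\binom{n}{n/2}$ if $n$ is even.
   Context: The Legendre polynomials $P_n(x)$ are given by $P_0(x)=1$, $P_1(x)=x$ and $(n+1)P_{n+1}(x)-(2n+1)xP_n(x)+nP_{n-1}(x)=0$ for $n\ge 1$. The integrand is a polynomial, since $P_n(x)-P_n(0)$ is divisible by $x$. *)

theory Defs
  imports "HOL-Analysis.Analysis" "HOL-Computational_Algebra.Polynomial"
begin

(* The three-term recurrence solved for its leading term; legendre_recurrence
   below gives it in the usual form. *)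
fun legendre :: "nat \<Rightarrow> real poly" where
  "legendre 0 = 1"
| "legendre (Suc 0) = [:0, 1:]"
| "legendre (Suc (Suc n)) =
     smult (1 / real (n + 2))
       (smult (real (2 * n + 3)) ([:0, 1:] * legendre (Suc n))
         - smult (real (n + 1)) (legendre n))"

lemma legendre_recurrence:
  assumes "n \<ge> 1"
  shows "real (n + 1) * poly (legendre (n + 1)) x
           - real (2 * n + 1) * x * poly (legendre n) x
           + real n * poly (legendre (n - 1)) x = 0"
proof -
  obtain m where n: "n = Suc m"
    using assms by (cases n) auto
  have "real (m + 2) \<noteq> 0"
    by simp
  then show ?thesis
    unfolding n by (simp add: field_simps)
qed

definition legendre_beta :: "nat \<Rightarrow> real" where
  "legendre_beta n = (if even n then real (n choose (n div 2)) / 2 ^ n else 0)"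

end

theory Submission
  imports Defs
begin

text \<open>
  Let \<open>c = P\<^sub>n(0)\<close> and let \<open>Q\<close> be the polynomial \<open>(P\<^sub>n(x) - c) / x\<close>, of degree less than \<open>n\<close>.
  Differentiating \<open>x Q = P\<^sub>n - c\<close> gives \<open>x Q' = P\<^sub>n' - Q\<close>, hence
  \<open>(x Q\<^sup>2)' = Q\<^sup>2 + 2 Q (x Q') = 2 Q P\<^sub>n' - Q\<^sup>2\<close>, so that
  \<open>\<integral> Q\<^sup>2 = 2 \<integral> Q P\<^sub>n' - [x Q\<^sup>2]\<close>, where integrals and boundary terms are taken over \<open>[-1, 1]\<close>.
  Integrating \<open>Q P\<^sub>n'\<close> by parts leaves only the boundary term \<open>[Q P\<^sub>n]\<close>, because \<open>Q'\<close> has degree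
  less than \<open>n\<close> and \<open>P\<^sub>n\<close> is orthogonal to all such polynomials.  Everything is thereby expressed
  through \<open>c\<close> and the endpoint values \<open>P\<^sub>n(1) = 1\<close>, \<open>P\<^sub>n(-1) = (-1)\<^sup>n\<close>; the result is
  \<open>2 (1 - c\<^sup>2)\<close>, and \<open>c\<^sup>2 = \<beta>(n)\<^sup>2\<close> since both sides obey the same two-step recursion.

  Orthogonality has to come from the three-term recurrence alone.  It follows from the moment
  relation \<open>(k + n + 2) \<integral> x\<^sup>k P\<^sub>n\<^sub>+\<^sub>1 = k \<integral> x\<^sup>k\<^sup>-\<^sup>1 P\<^sub>n\<close>
  (\<open>legendre_moment_step\<close>), which lowers the exponent and the index together until the factor
  \<open>k\<close> vanishes.
\<close>

abbreviation poly_integral :: "real poly \<Rightarrow> real" where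
  "poly_integral p \<equiv> integral {-1..1} (poly p)"

lemma poly_integrable [simp]: "poly p integrable_on {-1..1::real}" for p :: "real poly"
  by (intro integrable_continuous_interval continuous_on_poly continuous_on_id)

lemma poly_integral_add: "poly_integral (p + q) = poly_integral p + poly_integral q"
  using integral_add[of "poly p" "{-1..1}" "poly q"] by (simp add: poly_add[abs_def])

lemma poly_integral_diff: "poly_integral (p - q) = poly_integral p - poly_integral q"
  using integral_diff[of "poly p" "{-1..1}" "poly q"] by (simp add: poly_diff[abs_def])

lemma poly_integral_smult: "poly_integral (smult a p) = a * poly_integral p"
  by (simp add: poly_smult[abs_def])

lemma poly_integral_sum: "poly_integral (\<Sum>i\<in>A. f i) = (\<Sum>i\<in>A. poly_integral (f i))"
proof (induction A rule: infinite_finite_induct)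
  case (insert x A)
  then show ?case by (simp add: poly_integral_add del: poly_add)
qed (simp_all add: poly_0[abs_def])

lemma poly_integral_pderiv: "poly_integral (pderiv p) = poly p 1 - poly p (- 1)"
proof (rule integral_unique, rule fundamental_theorem_of_calculus)
  fix x :: real
  show "(poly p has_vector_derivative poly (pderiv p) x) (at x within {-1..1})"
    by (rule has_vector_derivative_at_within)
       (simp add: poly_DERIV has_real_derivative_iff_has_vector_derivative[symmetric])
qed simp

section \<open>Orthogonality of the Legendre polynomials\<close>

definition legendre_moment :: "nat \<Rightarrow> nat \<Rightarrow> real" where
  "legendre_moment k n = poly_integral (monom 1 k * legendre n)"

lemma legendre_moment_recurrence:
  "real (n + 2) * legendre_moment k (n + 2) =
     real (2 * n + 3) * legendre_moment (k + 1) (n + 1) - real (n + 1) * legendre_moment k n"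
proof -
  have x: "monom 1 (k + 1) = monom (1::real) k * [:0, 1:]"
    by (simp add: monom_Suc mult.commute)
  have "smult (real (n + 2)) (legendre (n + 2)) =
      smult (real (2 * n + 3)) ([:0, 1:] * legendre (n + 1)) - smult (real (n + 1)) (legendre n)"
    by (simp add: smult_diff_right del: mult_pCons_left)
  then have "monom 1 k * smult (real (n + 2)) (legendre (n + 2)) = monom 1 k *
      (smult (real (2 * n + 3)) ([:0, 1:] * legendre (n + 1)) - smult (real (n + 1)) (legendre n))"
    by (rule arg_cong)
  then have "smult (real (n + 2)) (monom 1 k * legendre (n + 2)) =
      smult (real (2 * n + 3)) (monom 1 (k + 1) * legendre (n + 1))
      - smult (real (n + 1)) (monom 1 k * legendre n)"
    by (simp only: x right_diff_distrib mult_smult_right mult.assoc)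
  then have "poly_integral (smult (real (n + 2)) (monom 1 k * legendre (n + 2))) =
      poly_integral (smult (real (2 * n + 3)) (monom 1 (k + 1) * legendre (n + 1))
        - smult (real (n + 1)) (monom 1 k * legendre n))"
    by (rule arg_cong)
  then show ?thesis
    by (simp only: legendre_moment_def poly_integral_smult poly_integral_diff)
qed

lemma legendre_moment_0:
  "real (k + 1) * legendre_moment k 0 = 1 + (- 1) ^ k"
proof -
  have "poly_integral (pderiv (monom 1 (k + 1))) = 1 + (- 1) ^ k"
    by (simp add: poly_integral_pderiv poly_monom)
  moreover have "pderiv (monom 1 (k + 1)) = smult (real (k + 1)) (monom (1::real) k)"
    by (simp add: pderiv_monom smult_monom)
  ultimately show ?thesis
    by (simp only: legendre_moment_def poly_integral_smult legendre.simps mult_1_right)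
qed

lemma legendre_moment_1: "legendre_moment k 1 = legendre_moment (k + 1) 0"
proof -
  have "monom 1 k * legendre 1 = monom 1 (k + 1) * legendre 0"
    by (simp add: monom_Suc mult.commute)
  then show ?thesis
    by (simp only: legendre_moment_def)
qed

text \<open>
  Both sides at index \<open>n = m + 1\<close> equal \<open>(k - m) \<integral> x\<^sup>k P\<^sub>m\<close>.  On the left, the recurrence
  writes \<open>P\<^sub>m\<^sub>+\<^sub>2\<close> through \<open>x P\<^sub>m\<^sub>+\<^sub>1\<close> and \<open>P\<^sub>m\<close>, and the induction hypothesis reduces the moment of
  \<open>P\<^sub>m\<^sub>+\<^sub>1\<close> to one of \<open>P\<^sub>m\<close>.  On the right, it writes \<open>P\<^sub>m\<^sub>+\<^sub>1\<close> through \<open>x P\<^sub>m\<close> and \<open>P\<^sub>m\<^sub>-\<^sub>1\<close>,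
  and the induction hypothesis raises the moment of \<open>P\<^sub>m\<^sub>-\<^sub>1\<close> to one of \<open>P\<^sub>m\<close>.
\<close>
lemma legendre_moment_step:
  "real (k + n + 2) * legendre_moment k (n + 1) = real k * legendre_moment (k - 1) n"
proof (induction n arbitrary: k rule: less_induct)
  case (less n)
  show ?case
  proof (cases n)
    case 0
    show ?thesis
    proof (cases k)
      case 0
      with \<open>n = 0\<close> show ?thesis
        using legendre_moment_0[of 1] legendre_moment_1[of 0] by simp
    next
      case (Suc j)
      have "real (k + 2) * legendre_moment k 1 = 1 + (- 1) ^ (k + 1)"
        using legendre_moment_0[of "k + 1"] legendre_moment_1[of k] by simp
      moreover have "real k * legendre_moment (k - 1) 0 = 1 + (- 1) ^ (k + 1)"
        using legendre_moment_0[of j] Suc by simp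
      ultimately show ?thesis using \<open>n = 0\<close> by simp
    qed
  next
    case (Suc m)
    have left: "real (k + m + 3) * legendre_moment k (m + 2) = (real k - real m) * legendre_moment k m"
    proof -
      have "(real k + real m + 3) * legendre_moment (k + 1) (m + 1)
          = (real k + 1) * legendre_moment k m"
        using less.IH[of m "k + 1"] Suc by (simp add: algebra_simps)
      moreover have "(real m + 2) * legendre_moment k (m + 2)
          = (2 * real m + 3) * legendre_moment (k + 1) (m + 1) - (real m + 1) * legendre_moment k m"
        using legendre_moment_recurrence[of m k] by (simp add: add.commute)
      ultimately have "(real m + 2) * ((real k + real m + 3) * legendre_moment k (m + 2))
          = (real m + 2) * ((real k - real m) * legendre_moment k m)"
        by algebra
      moreover have "real m + 2 \<noteq> 0" by linarith
      ultimately show ?thesis by simp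
    qed
    have right: "real k * legendre_moment (k - 1) (m + 1) = (real k - real m) * legendre_moment k m"
    proof (cases m)
      case 0
      then show ?thesis
        using legendre_moment_1[of "k - 1"] by (cases k) auto
    next
      case (Suc l)
      have IH: "(real k + real l + 2) * legendre_moment k (l + 1) = real k * legendre_moment (k - 1) l"
        using less.IH[of l k] \<open>n = Suc m\<close> Suc by (simp add: add_ac)
      show ?thesis
      proof (cases k)
        case 0
        then show ?thesis using IH Suc by simp
      next
        case (Suc j)
        have "(real l + 2) * legendre_moment (k - 1) (l + 2)
            = (2 * real l + 3) * legendre_moment k (l + 1) - (real l + 1) * legendre_moment (k - 1) l"
          using legendre_moment_recurrence[of l j] Suc by (simp add: add.commute)
        with IH have "(real l + 2) * (real k * legendre_moment (k - 1) (l + 2))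
            = (real l + 2) * ((real k - (real l + 1)) * legendre_moment k (l + 1))"
          by algebra
        moreover have "real l + 2 \<noteq> 0" by linarith
        ultimately show ?thesis using \<open>m = Suc l\<close> by (simp add: add.commute)
      qed
    qed
    from left right Suc show ?thesis by (simp add: algebra_simps)
  qed
qed

lemma legendre_moment_eq_0:
  assumes "k < n"
  shows "legendre_moment k n = 0"
  using assms
proof (induction n arbitrary: k)
  case (Suc n)
  have "real k * legendre_moment (k - 1) n = 0"
    using Suc by (cases k) auto
  then have "real (k + n + 2) * legendre_moment k (n + 1) = 0"
    by (simp only: legendre_moment_step)
  moreover have "real (k + n + 2) \<noteq> 0"
    by linarith
  ultimately show ?case
    by (simp only: mult_eq_0_iff Suc_eq_plus1) blast
qed simp

lemma legendre_orthogonal: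
  assumes "degree q < n"
  shows "poly_integral (q * legendre n) = 0"
proof -
  have "q * legendre n = (\<Sum>i\<le>degree q. smult (coeff q i) (monom 1 i * legendre n))"
    by (subst (1) poly_as_sum_of_monoms[symmetric])
       (simp add: sum_distrib_right smult_monom flip: mult_smult_left)
  then have "poly_integral (q * legendre n) =
      (\<Sum>i\<le>degree q. coeff q i * legendre_moment i n)"
    by (simp only: poly_integral_sum poly_integral_smult legendre_moment_def)
  also have "\<dots> = 0"
    using assms by (intro sum.neutral) (simp add: legendre_moment_eq_0)
  finally show ?thesis .
qed

section \<open>Degree and special values\<close>

lemma degree_legendre_le: "degree (legendre n) \<le> n"
proof (induction n rule: legendre.induct)
  case (3 n)
  have "degree ([:0, 1:] * legendre (Suc n)) \<le> Suc (Suc n)"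
    using degree_mult_le[of "[:0, 1:]" "legendre (Suc n)"] 3 by simp
  then show ?case
    using 3 by (auto intro!: degree_diff_le order.trans[OF degree_smult_le])
qed auto

lemma poly_legendre_1: "poly (legendre n) 1 = 1"
  by (induction n rule: legendre.induct) (simp_all add: field_simps)

lemma poly_legendre_minus_1: "poly (legendre n) (- 1) = (- 1) ^ n"
  by (induction n rule: legendre.induct) (simp_all add: field_simps)

lemma legendre_beta_step: "legendre_beta (n + 2) = real (n + 1) / real (n + 2) * legendre_beta n"
proof (cases "even n")
  case True
  then obtain m where n: "n = 2 * m" by blast
  have "real ((2 * m + 2) choose (m + 1)) = fact (2 * m + 2) / (fact (m + 1) * fact (m + 1))"
    using binomial_fact[of "m + 1" "2 * m + 2", where 'a = real] by simp
  also have "\<dots> = 2 * (2 * real m + 1) / (real m + 1) * (fact (2 * m) / (fact m * fact m))"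
    by (simp add: divide_simps) (simp add: algebra_simps)
  also have "fact (2 * m) / (fact m * fact m) = real ((2 * m) choose m)"
    using binomial_fact[of m "2 * m", where 'a = real] by simp
  finally show ?thesis
    by (simp add: n legendre_beta_def divide_simps) (simp add: algebra_simps)
qed (simp add: legendre_beta_def)

text \<open>
  At \<open>0\<close> the middle term of the recurrence drops out, so up to a sign the values \<open>P\<^sub>n(0)\<close> follow
  the recursion of the normalised central binomial coefficients.
\<close>
lemma poly_legendre_0_power2: "(poly (legendre n) 0)\<^sup>2 = (legendre_beta n)\<^sup>2"
proof (induction n rule: legendre.induct)
  case (3 n)
  have "poly (legendre (n + 2)) 0 = - (real (n + 1) / real (n + 2) * poly (legendre n) 0)"
    by simp
  then show ?case
    using 3 legendre_beta_step[of n] by (simp add: power_mult_distrib power_divide)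
qed (simp_all add: legendre_beta_def)

section \<open>The integral\<close>

text \<open>
  Integration by parts leaves only boundary terms: \<open>q'\<close> has degree less than \<open>n\<close>, so it is
  orthogonal to \<open>P\<^sub>n\<close> (or it is \<open>0\<close>, when \<open>q\<close> is constant).
\<close>
lemma poly_integral_mult_pderiv_legendre:
  assumes "degree q \<le> n"
  shows "poly_integral (q * pderiv (legendre n)) = poly q 1 - (- 1) ^ n * poly q (- 1)"
proof -
  have "poly_integral (pderiv q * legendre n) = 0"
  proof (cases "degree q = 0")
    case True
    then show ?thesis by (simp add: pderiv_eq_0_iff[THEN iffD2] poly_0[abs_def])
  next
    case False
    then show ?thesis using assms by (intro legendre_orthogonal) (simp add: degree_pderiv)
  qed
  moreover have "poly_integral (pderiv (q * legendre n))
      = poly_integral (q * pderiv (legendre n)) + poly_integral (pderiv q * legendre n)"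
    by (simp only: pderiv_mult poly_integral_add mult.commute)
  ultimately show ?thesis
    by (simp add: poly_integral_pderiv poly_legendre_1 poly_legendre_minus_1 mult.commute)
qed

text \<open>
  The values at the endpoints are \<open>Q(1) = 1 - c\<close> and \<open>Q(-1) = c - (-1)\<^sup>n\<close>.  For even \<open>n\<close> the
  integral is therefore \<open>4 (1 - c) - 2 (1 - c)\<^sup>2 = 2 (1 - c\<^sup>2)\<close>; for odd \<open>n\<close> the constant \<open>c\<close>
  vanishes and it is \<open>4 - 2 = 2\<close>.
\<close>
lemma poly_integral_legendre_quotient:
  assumes P: "legendre n = pCons c Q"
  shows "poly_integral (Q\<^sup>2) = 2 * (1 - c\<^sup>2)"
proof -
  have "degree Q \<le> n"
    using degree_legendre_le[of n] P by (cases "Q = 0") auto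
  then have by_parts: "poly_integral (Q * pderiv (legendre n)) = poly Q 1 - (- 1) ^ n * poly Q (- 1)"
    by (rule poly_integral_mult_pderiv_legendre)
  \<comment> \<open>This is \<open>(x Q\<^sup>2)' = 2 Q P\<^sub>n' - Q\<^sup>2\<close>; the doubled term is written as a sum.\<close>
  have "pderiv ([:0, 1:] * Q\<^sup>2) = Q * pderiv (legendre n) + Q * pderiv (legendre n) - Q\<^sup>2"
    by (simp add: P pderiv_pCons pderiv_mult power2_eq_square algebra_simps)
  then have "poly_integral (pderiv ([:0, 1:] * Q\<^sup>2)) =
      2 * (poly Q 1 - (- 1) ^ n * poly Q (- 1)) - poly_integral (Q\<^sup>2)"
    by (simp only: poly_integral_diff poly_integral_add by_parts mult_2)
  then have "poly Q 1 ^ 2 + poly Q (- 1) ^ 2 =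
      2 * (poly Q 1 - (- 1) ^ n * poly Q (- 1)) - poly_integral (Q\<^sup>2)"
    unfolding poly_integral_pderiv by simp
  moreover have Q1: "poly Q 1 = 1 - c"
    using poly_legendre_1[of n] P by simp
  moreover have Qm1: "poly Q (- 1) = c - (- 1) ^ n"
    using poly_legendre_minus_1[of n] P by simp
  moreover have "c = 0" if "odd n"
    using poly_legendre_0_power2[of n] that P by (simp add: legendre_beta_def)
  ultimately show ?thesis
    by (cases "even n") (simp_all add: power2_eq_square algebra_simps)
qed

theorem theorem1p2:
  fixes n :: nat
  assumes "n > 0"
  shows "((\<lambda>x::real. ((poly (legendre n) x - poly (legendre n) 0) / x)\<^sup>2)
           has_integral 2 * (1 - (legendre_beta n)\<^sup>2)) {-1..1}"
proof -
  obtain c Q where P: "legendre n = pCons c Q"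
    by (cases "legendre n")
  have "poly_integral (Q\<^sup>2) = 2 * (1 - (legendre_beta n)\<^sup>2)"
    using poly_integral_legendre_quotient[OF P] poly_legendre_0_power2[of n] P by simp
  then have "(poly (Q\<^sup>2) has_integral 2 * (1 - (legendre_beta n)\<^sup>2)) {-1..1}"
    using integrable_integral[OF poly_integrable, of "Q\<^sup>2"] by (simp only:)
  \<comment> \<open>At \<open>x = 0\<close> division by zero gives the integrand the value \<open>0\<close>, which may differ from \<open>Q(0)\<^sup>2\<close>.\<close>
  then show ?thesis
    by (rule has_integral_spike_finite[of "{0}", rotated 2]) (simp_all add: P)
qed

end
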